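(* Let $\alpha, n$ be nonnegative integers and let $p_1,\dots,p_{\alpha+1}$ be primes (not necessarily distinct) such that $b_{25}(p_i-1)\equiv 0 \pmod{5}$ for every $1\le i\le \alpha+1$. Then for any integer $j$ with $j \not\equiv 0 \pmod{p_{\alpha+1}}$, we have $$ b_{25}\left(p_1^2\cdots p_{\alpha+1}^2n+p_1^2\cdots p_{\alpha}^2p_{\alpha +1}(j+p_{\alpha +1})-1\right)\equiv 0 \pmod{5}.$$
   Context: For a positive integer $\ell$, an $\ell$-regular partition of a nonnegative integer $n$ is a partition of $n$ none of whose parts is divisible by $\ell$. The number of $\ell$-regular partitions of $n$ is denoted $b_\ell(n)$, with the conventions $b_\ell(0)=1$ and $b_\ell(n)=0$ for $n<0$. Its generating function is $\sum_{n=0}^\infty b_\ell(n)q^n=\prod_{i\ge 1}\frac{1-q^{\ell i}}{1-q^i}$. When $\alpha=0$, the empty product $p_1^2\cdots p_\alpha^2$ equals $1$. *)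

theory Defs
  imports "HOL-Library.Multiset" "HOL-Number_Theory.Number_Theory"
begin

definition partitions :: "nat \<Rightarrow> nat multiset set" where
  "partitions n = {M. 0 \<notin># M \<and> sum_mset M = n}"

definition regular_partitions :: "nat \<Rightarrow> nat \<Rightarrow> nat multiset set" where
  "regular_partitions l n = {M \<in> partitions n. \<forall>k\<in>#M. \<not> l dvd k}"

text \<open>
  The second argument is an integer because the count is also used at negative
  arguments, where it is zero by convention.
\<close>

definition num_regular_partitions :: "nat \<Rightarrow> int \<Rightarrow> nat" where
  "num_regular_partitions l n = (if n < 0 then 0 else card (regular_partitions l (nat n)))"

text \<open>Since \<^const>\<open>card\<close> is zero on infinite sets, the count is meaningful only with finiteness.\<close>

lemma size_le_sum_mset: "0 \<notin># M \<Longrightarrow> size M \<le> sum_mset (M :: nat multiset)"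
  by (induction M) auto

lemma finite_partitions: "finite (partitions n)"
proof -
  have "partitions n \<subseteq> (\<lambda>xs. mset xs) ` {xs. set xs \<subseteq> {..n} \<and> length xs \<le> n}"
  proof
    fix M assume "M \<in> partitions n"
    then have M: "0 \<notin># M" "sum_mset M = n" by (auto simp: partitions_def)
    obtain xs where xs: "M = mset xs" by (metis ex_mset)
    have "length xs \<le> n" using size_le_sum_mset[OF M(1)] M(2) xs by simp
    moreover have "set xs \<subseteq> {..n}"
      using M(2) xs member_le_sum_list by (fastforce simp: sum_mset_sum_list)
    ultimately show "M \<in> (\<lambda>xs. mset xs) ` {xs. set xs \<subseteq> {..n} \<and> length xs \<le> n}"
      using xs by auto
  qed
  then show ?thesis
    using finite_lists_length_le[of "{..n}" n] finite_subset by blast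
qed

lemma finite_regular_partitions: "finite (regular_partitions l n)"
  by (rule finite_subset[OF _ finite_partitions[of n]]) (auto simp: regular_partitions_def)

lemma num_regular_partitions_neg: "n < 0 \<Longrightarrow> num_regular_partitions l n = 0"
  by (simp add: num_regular_partitions_def)

lemma num_regular_partitions_0: "num_regular_partitions l 0 = 1"
proof -
  have "regular_partitions l 0 = {{#}}"
    using size_le_sum_mset by (fastforce simp: regular_partitions_def partitions_def simp del: sum_mset_0_iff)
  then show ?thesis by (simp add: num_regular_partitions_def)
qed

end

theory Submission
  imports Defs "HOL-Computational_Algebra.Formal_Power_Series"
begin

text \<open>
  Modulo 5, the count $b_{25}(m-1)$ is $m\,\sigma(m)$, where $\sigma$ is the sum of divisors.
  Once this is known the theorem is elementary: for a prime $p$ the hypothesis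
  $5 \mid b_{25}(p-1)$ says $5 \mid p(p+1)$, and the argument in the conclusion is $m - 1$ for an $m$
  that is either nonpositive or contains $p_{\alpha+1}$ to an odd power. If $p_{\alpha+1} = 5$, then
  $5 \mid m$; otherwise $5 \mid p_{\alpha+1}+1$, and $p_{\alpha+1}+1$ divides $\sigma(m)$.

  For the congruence, $(1-q^i)^5 \equiv 1-q^{5i}$ turns the generating function
  $\prod_i (1-q^{25i})/(1-q^i)$ into $C = \prod_i (1-q^{5i})^5/(1-q^i)$. An identity of Ramanujan
  expands this eta quotient exactly:
  $q\,C = \sum_m \bigl(\sum_{ax=m} (\frac a5)\,x\bigr) q^m$.
  Since $(\frac a5) \equiv a^2$ modulo 5, the coefficient of $q^m$ is congruent to
  $\sum_{ax=m} a^2 x = m\,\sigma(m)$.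

  Ramanujan's identity is proved here without analysis. The logarithmic derivative of $C$ shows that
  its coefficients $c$ satisfy $n\,c(n) = \sum_{k=1}^n L(k)\,c(n-k)$ with
  $L(k) = \sum_{d \mid k} d - 25\sum_{5d \mid k} d$, and over the integers this recurrence
  determines $c$ from $c(0)=1$. So it suffices that the twisted divisor sums satisfy the same recurrence
  (\<open>twisted_sigma_recurrence\<close>). That is a convolution identity of Liouville's kind, a sum over the
  positive solutions of $ax+by=n$. The map $(a,b,x,y) \mapsto (a,b-a,x+y,y)$ is a bijection from the
  solutions with $a<b$ to those with $y<x$. A function symmetric under
  exchanging $(a,x)$ with $(b,y)$ is therefore summed in two ways, and if the map changes that function
  by exactly the summand of the convolution, only the solutions with $a=b$ or $x=y$
  remain. Such a function is built from \<open>period5\<close> below.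
\<close>

section \<open>A Liouville-type convolution identity for the character modulo 5\<close>

definition legendre5 :: "nat \<Rightarrow> int" where
  "legendre5 a = [0, 1, -1, -1, 1] ! (a mod 5)"

text \<open>
  The factor $1-q^b$ occurs in $\prod_i (1-q^{5i})^5/(1-q^i)$ to the power $-w(b)$, with $w$ this weight.
\<close>

definition weight5 :: "nat \<Rightarrow> int" where
  "weight5 b = (if 5 dvd b then -4 else 1)"

definition twisted_sigma :: "nat \<Rightarrow> int" where
  "twisted_sigma m = (\<Sum>(a, x)\<in>{(a, x). a * x = m}. legendre5 a * int x)"

definition weighted_sigma :: "nat \<Rightarrow> int" where
  "weighted_sigma m = (\<Sum>(b, y)\<in>{(b, y). b * y = m}. int b * weight5 b)"

text \<open>
  Write the two tables as $\alpha(a,b)$ and $\beta(a,b)$. They are chosen so that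
  \<open>period5_shift\<close> and \<open>period5_three_term\<close> hold. Look for tables that are homogeneous,
  $\alpha(ua,ub) = (\frac u5)\,\alpha(a,b)$ for units $u$ and likewise for $\beta$, so that the row
  $a = 1$ and the value at $(0,1)$ determine everything. Comparing coefficients in the two relations then leaves a
  linear system which forces $\beta(1,\cdot)$ to be the centred sawtooth $2,-2,-1,0,1$,
  whose differences are the values of \<open>weight5\<close>, and $\beta(0,1)=0$,
  $\alpha(1,\cdot) = -2,0,1,1,0$, $\alpha(0,1)=2$.
\<close>

definition period5 :: "nat \<Rightarrow> nat \<Rightarrow> int" where
  "period5 a b =
     int a * ([[ 0,  2, -2, -2,  2],
               [-2,  0,  1,  1,  0],
               [ 2, -1,  0,  0, -1],
               [ 2, -1,  0,  0, -1],
               [-2,  0,  1,  1,  0]] ! (a mod 5) ! (b mod 5)) +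
     int b * ([[ 0,  0,  0,  0,  0],
               [ 2, -2, -1,  0,  1],
               [-2,  0,  2, -1,  1],
               [-2,  1, -1,  2,  0],
               [ 2,  1,  0, -1, -2]] ! (a mod 5) ! (b mod 5))"

lemma mod_5_simps:
  "(5 * k) mod 5 = 0" "(5 * k + 1) mod 5 = 1" "(5 * k + 2) mod 5 = 2"
  "(5 * k + 3) mod 5 = 3" "(5 * k + 4) mod 5 = (4::nat)"
  by presburger+

lemma less_5_cases: "r < 5 \<Longrightarrow> r = 0 \<or> r = 1 \<or> r = 2 \<or> r = 3 \<or> r = (4::nat)"
  by linarith

text \<open>
  The shift relation supplies the summand $(\frac a5)\,x \cdot b\,w(b)$ of the convolution. It and the
  next relation are identities between linear forms in $a$ and $b$ for each of the 25 residue pairs.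
\<close>

lemma period5_shift: "period5 a (a + b) = period5 a b + legendre5 a * (int b * weight5 b)"
proof -
  have dvd: "5 dvd b \<longleftrightarrow> b mod 5 = 0" by presburger
  have m: "(a + b) mod 5 = (a mod 5 + b mod 5) mod 5" by (simp add: mod_add_eq)
  have "a mod 5 < 5" "b mod 5 < 5" by simp_all
  then show ?thesis
    unfolding period5_def legendre5_def weight5_def dvd m
    by (elim less_5_cases[THEN disjE] disjE) (simp_all add: algebra_simps)
qed

text \<open>
  The analogue of the three-term relation of period polynomials. It makes the transformed function
  symmetric again after the shift terms have been split off.
\<close>

lemma period5_three_term: "period5 (a + b) a = period5 a (a + b) + period5 b (a + b)"
proof -
  have m: "(a + b) mod 5 = (a mod 5 + b mod 5) mod 5" by (simp add: mod_add_eq)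
  have "a mod 5 < 5" "b mod 5 < 5" by simp_all
  then show ?thesis
    unfolding period5_def m
    by (elim less_5_cases[THEN disjE] disjE) (simp_all add: algebra_simps)
qed

lemma period5_diag: "period5 a a = - 2 * int a * legendre5 a"
proof -
  have "a mod 5 < 5" by simp
  then show ?thesis
    unfolding period5_def legendre5_def
    by (elim less_5_cases[THEN disjE] disjE) (simp_all add: algebra_simps)
qed

lemma sum_lessThan_add5:
  fixes f :: "nat \<Rightarrow> int"
  shows "(\<Sum>a<5 * Suc k. f a) =
    (\<Sum>a<5 * k. f a) + f (5*k) + f (5*k+1) + f (5*k+2) + f (5*k+3) + f (5*k+4)"
proof -
  have "5 * Suc k = Suc (Suc (Suc (Suc (Suc (5 * k)))))" by simp
  show ?thesis unfolding \<open>5 * Suc k = _\<close> sum.lessThan_Suc by (simp add: eval_nat_numeral)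
qed

lemma sum_period5_less_multiple_5:
  "(\<Sum>a<5 * k. period5 a s) = - 5 * int k * legendre5 s"
proof (induction k)
  case 0 show ?case by simp
next
  case (Suc k)
  have "s mod 5 < 5" by simp
  then have "period5 (5*k) s + period5 (5*k+1) s + period5 (5*k+2) s + period5 (5*k+3) s + period5 (5*k+4) s = - 5 * legendre5 s"
    unfolding period5_def legendre5_def mod_5_simps
    by (elim less_5_cases[THEN disjE] disjE) (simp_all add: algebra_simps)
  then show ?case
    unfolding sum_lessThan_add5 Suc by (simp add: algebra_simps)
qed

lemma period5_0_left: "period5 0 s = 0"
proof -
  have "s mod 5 < 5" by simp
  then show ?thesis
    unfolding period5_def by (elim less_5_cases[THEN disjE] disjE) simp_all
qed

text \<open>
  This evaluates the contribution of the solutions with $x=y$. Summing over whole periods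
  in $a$ cancels all of $\beta$ (\<open>sum_period5_less_multiple_5\<close>), so only an incomplete period has to be added.
\<close>

lemma sum_period5_lessThan:
  assumes "0 < s"
  shows "(\<Sum>a=1..<s. period5 a s) = (int s - 1) * legendre5 s"
proof -
  define k where "k = s div 5"
  have lt: "(\<Sum>a=1..<s. period5 a s) = (\<Sum>a<s. period5 a s)"
    using assms by (simp add: lessThan_atLeast0 sum.atLeast_Suc_lessThan period5_0_left)
  have sum_lessThan_cong: "(\<Sum>a<s. period5 a s) = (\<Sum>a<t. period5 a s)" if "s = t" for t
    using that by simp
  have "s mod 5 < 5" by simp
  moreover have s: "s = 5 * k + s mod 5" unfolding k_def by simp
  ultimately consider "s = 5 * k" | "s = Suc (5 * k)" | "s = Suc (Suc (5 * k))"
    | "s = Suc (Suc (Suc (5 * k)))" | "s = Suc (Suc (Suc (Suc (5 * k))))"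
    by linarith
  then show ?thesis
  proof cases
    case 1
    show ?thesis unfolding lt sum_lessThan_cong[OF 1] by (simp add: sum_period5_less_multiple_5 1 legendre5_def)
  next
    case 2
    have m: "s mod 5 = 1" using 2 by presburger
    have "(\<Sum>a<s. period5 a s) = - 5 * int k * legendre5 s + period5 (5*k) s"
      unfolding sum_lessThan_cong[OF 2] by (simp add: sum_period5_less_multiple_5)
    also have "\<dots> = (int s - 1) * legendre5 s"
      unfolding period5_def legendre5_def m mod_5_simps using 2 by simp
    finally show ?thesis unfolding lt .
  next
    case 3
    have m: "s mod 5 = 2" using 3 by presburger
    have "(\<Sum>a<s. period5 a s) = - 5 * int k * legendre5 s + period5 (5*k) s + period5 (5*k+1) s"
      unfolding sum_lessThan_cong[OF 3] by (simp add: sum_period5_less_multiple_5)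
    also have "\<dots> = (int s - 1) * legendre5 s"
      unfolding period5_def legendre5_def m mod_5_simps using 3 by simp
    finally show ?thesis unfolding lt .
  next
    case 4
    have m: "s mod 5 = 3" using 4 by presburger
    have "(\<Sum>a<s. period5 a s) = - 5 * int k * legendre5 s + period5 (5*k) s + period5 (5*k+1) s + period5 (5*k+2) s"
      unfolding sum_lessThan_cong[OF 4] by (simp add: sum_period5_less_multiple_5)
    also have "\<dots> = (int s - 1) * legendre5 s"
      unfolding period5_def legendre5_def m mod_5_simps using 4 by simp
    finally show ?thesis unfolding lt .
  next
    case 5
    have m: "s mod 5 = 4" using 5 by presburger
    have "(\<Sum>a<s. period5 a s) = - 5 * int k * legendre5 s + period5 (5*k) s + period5 (5*k+1) s + period5 (5*k+2) s
        + period5 (5*k+3) s"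
      unfolding sum_lessThan_cong[OF 5] by (simp add: sum_period5_less_multiple_5 numeral_2_eq_2 numeral_3_eq_3)
    also have "\<dots> = (int s - 1) * legendre5 s"
      unfolding period5_def legendre5_def m mod_5_simps using 5 by simp
    finally show ?thesis unfolding lt .
  qed
qed

definition quads :: "nat \<Rightarrow> (nat \<times> nat \<times> nat \<times> nat) set" where
  "quads n = {(a, b, x, y). 0 < a \<and> 0 < b \<and> 0 < x \<and> 0 < y \<and> a * x + b * y = n}"

lemma finite_quads: "finite (quads n)"
proof (rule finite_subset)
  show "quads n \<subseteq> {..n} \<times> {..n} \<times> {..n} \<times> {..n}"
  proof
    fix q assume "q \<in> quads n"
    then obtain a b x y where q: "q = (a, b, x, y)" "0 < a" "0 < b" "0 < x" "0 < y" "a * x + b * y = n"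
      by (auto simp: quads_def)
    have "a \<le> a * x" "x \<le> a * x" "b \<le> b * y" "y \<le> b * y"
      using q(2-5) by simp_all
    then have "a \<le> n" "b \<le> n" "x \<le> n" "y \<le> n" using q(6) by linarith+
    then show "q \<in> {..n} \<times> {..n} \<times> {..n} \<times> {..n}" using q(1) by simp
  qed
qed simp

lemma sum_quads_by_ab:
  fixes f :: "nat \<Rightarrow> nat \<Rightarrow> nat \<Rightarrow> nat \<Rightarrow> int"
  shows "(\<Sum>(a,b,x,y)\<in>quads n. f a b x y) =
      (\<Sum>(a,b,x,y)\<in>{(a,b,x,y)\<in>quads n. a = b}. f a b x y) +
      (\<Sum>(a,b,x,y)\<in>{(a,b,x,y)\<in>quads n. a < b}. f a b x y + f b a y x)"
proof -
  let ?Q = "\<lambda>P. {(a,b,x,y)\<in>quads n. P a b x y}"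
  let ?f = "\<lambda>(a,b,x,y). f a b x y"
  have split: "quads n = ?Q (\<lambda>a b x y. a = b) \<union> (?Q (\<lambda>a b x y. a < b) \<union> ?Q (\<lambda>a b x y. b < a))"
    by auto
  have fin: "finite (?Q P)" for P
    by (rule finite_subset[OF _ finite_quads[of n]]) auto
  have "sum ?f (quads n) = sum ?f (?Q (\<lambda>a b x y. a = b)) +
      (sum ?f (?Q (\<lambda>a b x y. a < b)) + sum ?f (?Q (\<lambda>a b x y. b < a)))"
    by (subst split, subst sum.union_disjoint[OF fin finite_UnI[OF fin fin]], force,
        subst sum.union_disjoint[OF fin fin], force, rule refl)
  also have "sum ?f (?Q (\<lambda>a b x y. b < a)) =
      sum (\<lambda>(a,b,x,y). f b a y x) (?Q (\<lambda>a b x y. a < b))"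
    by (rule sum.reindex_bij_witness[where i = "\<lambda>(a,b,x,y). (b,a,y,x)" and j = "\<lambda>(a,b,x,y). (b,a,y,x)"])
       (auto simp: quads_def)
  finally show ?thesis by (simp add: sum.distrib case_prod_unfold)
qed

text \<open>
  The duality $(a,b,x,y) \mapsto (y,x,b,a)$ preserves $ax+by$ and turns the comparison of $a$ and $b$ into that
  of $x$ and $y$.
\<close>

lemma sum_quads_by_xy:
  fixes f :: "nat \<Rightarrow> nat \<Rightarrow> nat \<Rightarrow> nat \<Rightarrow> int"
  shows "(\<Sum>(a,b,x,y)\<in>quads n. f a b x y) =
      (\<Sum>(a,b,x,y)\<in>{(a,b,x,y)\<in>quads n. y = x}. f a b x y) +
      (\<Sum>(a,b,x,y)\<in>{(a,b,x,y)\<in>quads n. y < x}. f a b x y + f b a y x)"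
proof -
  have dual: "(\<Sum>(a,b,x,y)\<in>{(a,b,x,y)\<in>quads n. P a b x y}. g a b x y) =
     (\<Sum>(a,b,x,y)\<in>{(a,b,x,y)\<in>quads n. P y x b a}. g y x b a)"
    for P and g :: "nat \<Rightarrow> nat \<Rightarrow> nat \<Rightarrow> nat \<Rightarrow> int"
    by (rule sum.reindex_bij_witness[where i = "\<lambda>(a,b,x,y). (y,x,b,a)" and j = "\<lambda>(a,b,x,y). (y,x,b,a)"])
       (auto simp: quads_def mult.commute add.commute)
  show ?thesis
    using sum_quads_by_ab[of "\<lambda>a b x y. f y x b a" n]
      dual[where P = "\<lambda>_ _ _ _. True" and g = f] dual[where P = "\<lambda>a b x y. y = x" and g = f]
      dual[where P = "\<lambda>a b x y. y < x" and g = "\<lambda>a b x y. f a b x y + f b a y x"]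
    by (simp add: case_prod_unfold)
qed

text \<open>
  Liouville's bijection: $ax+by = a(x+y)+(b-a)y$.
\<close>

lemma sum_quads_less:
  fixes f :: "nat \<Rightarrow> nat \<Rightarrow> nat \<Rightarrow> nat \<Rightarrow> int"
  shows "(\<Sum>(a,b,x,y)\<in>{(a,b,x,y)\<in>quads n. a < b}. f a b x y) =
      (\<Sum>(a,b,x,y)\<in>{(a,b,x,y)\<in>quads n. y < x}. f a (a + b) (x - y) y)"
proof (rule sum.reindex_bij_witness[where i = "\<lambda>(a,b,x,y). (a, a + b, x - y, y)"
      and j = "\<lambda>(a,b,x,y). (a, b - a, x + y, y)"], goal_cases)
  case (1 q)
  then show ?case by auto
next
  case (2 q)
  then obtain a b x y where q: "q = (a,b,x,y)" "a < b" "0 < a" "0 < x" "0 < y" "a * x + b * y = n"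
    by (auto simp: quads_def)
  have "a * (x + y) + (b - a) * y = n"
  proof -
    obtain c where "b = a + c" using q(2) by (metis less_imp_add_positive)
    then show ?thesis using q(6) by (simp add: algebra_simps)
  qed
  then show ?case using q by (simp add: quads_def)
next
  case (3 q)
  then show ?case by auto
next
  case (4 q)
  then obtain a b x y where q: "q = (a,b,x,y)" "y < x" "0 < a" "0 < b" "0 < y" "a * x + b * y = n"
    by (auto simp: quads_def)
  have "a * (x - y) + (a + b) * y = n"
  proof -
    obtain c where "x = y + c" using q(2) by (metis less_imp_add_positive)
    then show ?thesis using q(6) by (simp add: algebra_simps)
  qed
  then show ?case using q by (simp add: quads_def)
next
  case (5 q)
  then show ?case by auto
qed



definition conv_term :: "nat \<Rightarrow> nat \<Rightarrow> nat \<Rightarrow> nat \<Rightarrow> int" where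
  "conv_term a b x y = legendre5 a * int x * (int b * weight5 b)"

lemma finite_divisor_pairs: "0 < m \<Longrightarrow> finite {(a, x). a * x = (m::nat)}"
  by (rule finite_subset[of _ "{..m} \<times> {..m}"]) (auto intro: Suc_leI)

text \<open>
  The symmetric function is $F = \varphi(a,b)\,x + \varphi(b,a)\,y$ with $\varphi$ = \<open>period5\<close>. Its
  sum is computed once by comparing $a$ with $b$ and once by comparing $x$ with $y$; by
  \<open>sum_quads_less\<close> the off-diagonal parts differ by the symmetrised summand.
\<close>

lemma sum_quads_conv_term_diagonals:
  "2 * (\<Sum>(a,b,x,y)\<in>quads n. conv_term a b x y) =
     (\<Sum>(a,b,x,y)\<in>{(a,b,x,y)\<in>quads n. y = x}. 2 * (period5 a (a + b) * int x)) -
     (\<Sum>(a,b,x,y)\<in>{(a,b,x,y)\<in>quads n. a = b}. period5 a a * (int x + int y))"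
proof -
  let ?F = "\<lambda>a b x y. period5 a b * int x + period5 b a * int y"
  let ?t = conv_term
  let ?D = "{(a,b,x,y)\<in>quads n. a = b}"
  let ?E = "{(a,b,x,y)\<in>quads n. y = x}"
  let ?L = "{(a,b,x,y)\<in>quads n. y < x}"
  \<comment> \<open>Moving along the bijection changes $F$ by the symmetrised summand.\<close>
  have F: "?F a (a + b) (x - y) y = ?F a b x y + (?t a b x y + ?t b a y x)" if "y < x" for a b x y
  proof -
    have xy: "int (x - y) = int x - int y" using that by simp
    have "period5 b (a + b) = period5 b a + legendre5 b * (int a * weight5 a)"
      using period5_shift[of b a] by (simp add: add.commute)
    then show ?thesis
      unfolding period5_three_term period5_shift[of a b] xy conv_term_def by (simp add: algebra_simps)
  qed
  have 1: "(\<Sum>(a,b,x,y)\<in>quads n. ?F a b x y) =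
      (\<Sum>(a,b,x,y)\<in>?D. ?F a b x y) + (\<Sum>(a,b,x,y)\<in>?L. 2 * ?F a b x y + 2 * (?t a b x y + ?t b a y x))"
  proof -
    have "(\<Sum>(a,b,x,y)\<in>quads n. ?F a b x y) =
      (\<Sum>(a,b,x,y)\<in>?D. ?F a b x y) + (\<Sum>(a,b,x,y)\<in>{(a,b,x,y)\<in>quads n. a < b}. 2 * ?F a b x y)"
      by (subst sum_quads_by_ab) (simp add: algebra_simps)
    also have "(\<Sum>(a,b,x,y)\<in>{(a,b,x,y)\<in>quads n. a < b}. 2 * ?F a b x y) =
       (\<Sum>(a,b,x,y)\<in>?L. 2 * ?F a (a + b) (x - y) y)"
      by (rule sum_quads_less)
    also have "\<dots> = (\<Sum>(a,b,x,y)\<in>?L. 2 * ?F a b x y + 2 * (?t a b x y + ?t b a y x))"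
      by (intro sum.cong refl) (auto simp only: F mem_Collect_eq split: prod.splits, simp add: algebra_simps)
    finally show ?thesis .
  qed
  have 2: "(\<Sum>(a,b,x,y)\<in>quads n. ?F a b x y) =
      (\<Sum>(a,b,x,y)\<in>?E. ?F a b x y) + (\<Sum>(a,b,x,y)\<in>?L. 2 * ?F a b x y)"
    by (subst sum_quads_by_xy) (simp add: algebra_simps)
  have 3: "(\<Sum>(a,b,x,y)\<in>quads n. ?t a b x y) =
      (\<Sum>(a,b,x,y)\<in>?E. ?t a b x y) + (\<Sum>(a,b,x,y)\<in>?L. ?t a b x y + ?t b a y x)"
    by (rule sum_quads_by_xy)
  \<comment> \<open>On $x=y$ the shift relation absorbs the summand into $\varphi(a,a+b)$.\<close>
  have E: "(\<Sum>(a,b,x,y)\<in>?E. ?F a b x y + 2 * ?t a b x y) =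
      (\<Sum>(a,b,x,y)\<in>?E. 2 * (period5 a (a + b) * int x))"
  proof -
    have "(\<Sum>(a,b,x,y)\<in>?E. period5 b a * int y) = (\<Sum>(a,b,x,y)\<in>?E. period5 a b * int x)"
      by (rule sum.reindex_bij_witness[where i = "\<lambda>(a,b,x,y). (b,a,y,x)" and j = "\<lambda>(a,b,x,y). (b,a,y,x)"])
         (auto simp: quads_def)
    then have "(\<Sum>(a,b,x,y)\<in>?E. ?F a b x y + 2 * ?t a b x y) =
      (\<Sum>(a,b,x,y)\<in>?E. 2 * (period5 a b * int x) + 2 * ?t a b x y)"
      by (simp add: case_prod_unfold sum.distrib flip: sum_distrib_left)
    also have "\<dots> = (\<Sum>(a,b,x,y)\<in>?E. 2 * (period5 a (a + b) * int x))"
      by (intro sum.cong refl) (auto simp: period5_shift conv_term_def algebra_simps)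
    finally show ?thesis .
  qed
  have D: "(\<Sum>(a,b,x,y)\<in>?D. ?F a b x y) = (\<Sum>(a,b,x,y)\<in>?D. period5 a a * (int x + int y))"
    by (intro sum.cong refl) (auto simp: algebra_simps)
  show ?thesis
    using 1 2 3 unfolding D[symmetric] E[symmetric]
    by (simp add: case_prod_unfold sum.distrib flip: sum_distrib_left)
qed

lemma sum_quads_x_eq_y:
  assumes "0 < n"
  shows "(\<Sum>(a,b,x,y)\<in>{(a,b,x,y)\<in>quads n. y = x}. f a (a + b) x) =
    (\<Sum>(s,x)\<in>{(s,x). s * x = n}. \<Sum>a=1..<s. (f a s x :: int))"
proof -
  have "(\<Sum>(a,b,x,y)\<in>{(a,b,x,y)\<in>quads n. y = x}. f a (a + b) x) =
    (\<Sum>((s,x),a)\<in>(SIGMA q:{(s,x). s * x = n}. {1..<fst q}). f a s x)"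
    by (rule sum.reindex_bij_witness[where i = "\<lambda>((s,x),a). (a,s-a,x,x)" and j = "\<lambda>(a,b,x,y). ((a+b,x),a)"])
       (use assms in \<open>auto simp: quads_def add_mult_distrib[symmetric] intro!: gr0I\<close>)
  also have "\<dots> = (\<Sum>(s,x)\<in>{(s,x). s * x = n}. \<Sum>a=1..<s. f a s x)"
    using sum.Sigma[of "{(s, x). s * x = n}" "\<lambda>q. {1..<fst q}" "\<lambda>q a. f a (fst q) (snd q)"]
      finite_divisor_pairs[OF assms] by (simp add: case_prod_unfold)
  finally show ?thesis .
qed

lemma sum_quads_a_eq_b:
  assumes "0 < n"
  shows "(\<Sum>(a,b,x,y)\<in>{(a,b,x,y)\<in>quads n. a = b}. g a (x + y)) =
    (\<Sum>(a,m)\<in>{(a,m). a * m = n}. (int m - 1) * (g a m :: int))"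
proof -
  have "(\<Sum>(a,b,x,y)\<in>{(a,b,x,y)\<in>quads n. a = b}. g a (x + y)) =
    (\<Sum>((a,m),x)\<in>(SIGMA q:{(a,m). a * m = n}. {1..<snd q}). g a m)"
    by (rule sum.reindex_bij_witness[where i = "\<lambda>((a,m),x). (a,a,x,m-x)" and j = "\<lambda>(a,b,x,y). ((a,x+y),x)"])
       (use assms in \<open>auto simp: quads_def add_mult_distrib2[symmetric] intro!: gr0I\<close>)
  also have "\<dots> = (\<Sum>(a,m)\<in>{(a,m). a * m = n}. \<Sum>x=1..<m. g a m)"
    using sum.Sigma[of "{(a, m). a * m = n}" "\<lambda>q. {1..<snd q}" "\<lambda>q x. g (fst q) (snd q)"]
      finite_divisor_pairs[OF assms] by (simp add: case_prod_unfold del: sum_constant)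
  also have "\<dots> = (\<Sum>(a,m)\<in>{(a,m). a * m = n}. (int m - 1) * g a m)"
    by (intro sum.cong refl) (use assms in \<open>auto simp: of_nat_diff Suc_le_eq intro!: gr0I\<close>)
  finally show ?thesis .
qed

lemma sum_quads_conv_term:
  assumes "0 < n"
  shows "(\<Sum>(a,b,x,y)\<in>quads n. conv_term a b x y) = (int n - 1) * twisted_sigma n"
proof -
  have "2 * (\<Sum>(a,b,x,y)\<in>quads n. conv_term a b x y) =
     (\<Sum>(s,x)\<in>{(s,x). s * x = n}. \<Sum>a=1..<s. 2 * (period5 a s * int x)) -
     (\<Sum>(a,m)\<in>{(a,m). a * m = n}. (int m - 1) * (period5 a a * int m))"
    unfolding sum_quads_conv_term_diagonals
    using sum_quads_x_eq_y[OF assms, of "\<lambda>a s x. 2 * (period5 a s * int x)"]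
      sum_quads_a_eq_b[OF assms, of "\<lambda>a m. period5 a a * int m"] by simp
  also have "\<dots> = (\<Sum>(s,x)\<in>{(s,x). s * x = n}.
      2 * ((int s - 1) * legendre5 s) * int x - (int x - 1) * (period5 s s * int x))"
    unfolding sum_subtractf[symmetric]
  proof (intro sum.cong refl, clarify)
    fix s x assume "n = s * x"
    with assms have "0 < s" by (auto intro!: gr0I)
    show "(\<Sum>a=1..<s. 2 * (period5 a s * int x)) - (int x - 1) * (period5 s s * int x) =
      2 * ((int s - 1) * legendre5 s) * int x - (int x - 1) * (period5 s s * int x)"
      unfolding sum_period5_lessThan[OF \<open>0 < s\<close>, symmetric] by (simp add: sum_distrib_left sum_distrib_right mult.assoc)
  qed
  also have "\<dots> = (\<Sum>(s,x)\<in>{(s,x). s * x = n}. 2 * (int n - 1) * (legendre5 s * int x))"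
    by (intro sum.cong refl) (auto simp: period5_diag algebra_simps)
  also have "\<dots> = 2 * ((int n - 1) * twisted_sigma n)"
    by (simp only: twisted_sigma_def sum_distrib_left case_prod_unfold mult.assoc)
  finally show ?thesis by simp
qed

text \<open>
  A product of a twisted and a weighted divisor sum is a sum over pairs of factorisations
  $ax = n+1-k$ and $by = k$, that is, over the positive solutions of $ax+by=n+1$.
\<close>

lemma twisted_sigma_recurrence:
  "int n * twisted_sigma (n + 1) = (\<Sum>k=1..n. weighted_sigma k * twisted_sigma (n + 1 - k))"
proof -
  let ?D = "\<lambda>m. {(a, x). a * x = (m::nat)}"
  have le: "b * y \<le> n" if "a * x + b * y = Suc n" "0 < a" "0 < x" for a b x y
  proof -
    have "0 < a * x" using that by simp
    with that(1) show ?thesis by linarith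
  qed
  have "(\<Sum>k=1..n. weighted_sigma k * twisted_sigma (n + 1 - k)) =
    (\<Sum>k=1..n. \<Sum>((b,y),(a,x))\<in>?D k \<times> ?D (n + 1 - k). conv_term a b x y)"
    unfolding weighted_sigma_def twisted_sigma_def sum_product sum.cartesian_product
    by (intro sum.cong refl) (auto simp: conv_term_def)
  also have "\<dots> = (\<Sum>(k,((b,y),(a,x)))\<in>(SIGMA k:{1..n}. ?D k \<times> ?D (n + 1 - k)). conv_term a b x y)"
    by (subst sum.Sigma) (auto simp: finite_divisor_pairs)
  also have "\<dots> = (\<Sum>(a,b,x,y)\<in>quads (n + 1). conv_term a b x y)"
    by (rule sum.reindex_bij_witness[where j = "\<lambda>(k,((b,y),(a,x))). (a,b,x,y)" and i = "\<lambda>(a,b,x,y). (b*y,((b,y),(a,x)))"])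
       (auto simp: quads_def intro: le intro!: gr0I)
  also have "\<dots> = int n * twisted_sigma (n + 1)"
    using sum_quads_conv_term[of "n + 1"] by simp
  finally show ?thesis by simp
qed



definition mset_gf :: "nat set \<Rightarrow> int fps" where
  "mset_gf I = Abs_fps (\<lambda>n. int (card {M. set_mset M \<subseteq> I \<and> sum_mset M = n}))"

lemma finite_msets_sum: "0 \<notin> I \<Longrightarrow> finite {M. set_mset M \<subseteq> I \<and> sum_mset M = (n::nat)}"
  by (rule finite_subset[OF _ finite_partitions[of n]]) (auto simp: partitions_def)

section \<open>Generating functions of multisets\<close>

lemma fps_nth_mult_one_minus_X_power:
  "fps_nth (f * (1 - fps_X ^ i)) n = fps_nth (f :: 'a :: comm_ring_1 fps) n - (if n < i then 0 else fps_nth f (n - i))"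
  by (simp add: right_diff_distrib fps_X_power_mult_right_nth)

text \<open>
  Multisets over \<open>insert i I\<close> either avoid \<open>i\<close> or arise from a smaller one by adding one
  copy of \<open>i\<close>.
\<close>

lemma mset_gf_insert:
  assumes "i \<notin> I" "0 \<notin> insert i I"
  shows "mset_gf (insert i I) * (1 - fps_X ^ i) = mset_gf I"
proof (rule fps_ext)
  fix n
  let ?P = "\<lambda>I n. {M. set_mset M \<subseteq> I \<and> sum_mset M = n}"
  have fin: "finite (?P I n)" "finite (?P (insert i I) n)" for n
    using assms by (intro finite_msets_sum; simp)+
  have i: "0 < i" using assms by auto
  have split: "?P (insert i I) n = ?P I n \<union> {M \<in> ?P (insert i I) n. i \<in># M}"
    by auto
  have "card (?P (insert i I) n) = card (?P I n) + card {M \<in> ?P (insert i I) n. i \<in># M}"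
  proof (subst split, rule card_Un_disjoint)
    show "finite {M \<in> ?P (insert i I) n. i \<in># M}"
      by (rule finite_subset[OF _ fin(2)[of n]]) auto
  qed (use fin assms in auto)
  also have "card {M \<in> ?P (insert i I) n. i \<in># M} = (if n < i then 0 else card (?P (insert i I) (n - i)))"
  proof (cases "n < i")
    case True
    then have none: "{M \<in> ?P (insert i I) n. i \<in># M} = {}"
      by (auto dest!: multi_member_split)
    show ?thesis unfolding none using True by simp
  next
    case False
    have "bij_betw (\<lambda>M. add_mset i M) (?P (insert i I) (n - i)) {M \<in> ?P (insert i I) n. i \<in># M}"
    proof (rule bij_betw_byWitness[where f' = "\<lambda>M. M - {#i#}"])
      show "(\<lambda>M. M - {#i#}) ` {M \<in> ?P (insert i I) n. i \<in># M} \<subseteq> ?P (insert i I) (n - i)"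
        by (auto dest: in_diffD dest!: multi_member_split)
    qed (use False in auto)
    then show ?thesis using False by (simp add: bij_betw_same_card)
  qed
  finally show "fps_nth (mset_gf (insert i I) * (1 - fps_X ^ i)) n = fps_nth (mset_gf I) n"
    by (simp add: mset_gf_def fps_nth_mult_one_minus_X_power)
qed

lemma mset_gf_times_prod:
  assumes "finite I" "0 \<notin> I"
  shows "mset_gf I * (\<Prod>i\<in>I. 1 - fps_X ^ i) = 1"
  using assms
proof (induction I rule: finite_induct)
  case empty
  have "{M. M = {#} \<and> sum_mset M = n} = (if n = 0 then {{#}} else {})" for n :: nat
    by auto
  then show ?case by (intro fps_ext) (simp add: mset_gf_def)
next
  case (insert i I)
  then show ?case
    using mset_gf_insert[of i I] by (simp flip: mult.assoc)
qed

section \<open>Logarithmic derivatives of power series\<close>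

text \<open>
  The operator is $q\,d/dq$, so that it multiplies the coefficient of $q^n$ by $n$. The relation is
  stated as a product because over the integers there is no division to define the quotient by.
\<close>

definition has_log_deriv :: "'a :: comm_ring_1 fps \<Rightarrow> 'a fps \<Rightarrow> bool" where
  "has_log_deriv f u \<longleftrightarrow> fps_X * fps_deriv f = f * u"

lemma has_log_deriv_1: "has_log_deriv 1 0"
  by (simp add: has_log_deriv_def)

lemma has_log_deriv_mult:
  "has_log_deriv f u \<Longrightarrow> has_log_deriv g v \<Longrightarrow> has_log_deriv (f * g) (u + v)"
proof -
  assume "has_log_deriv f u" "has_log_deriv g v"
  then have "f * (fps_X * fps_deriv g) + g * (fps_X * fps_deriv f) = f * (g * v) + g * (f * u)"
    unfolding has_log_deriv_def by simp
  then show ?thesis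
    unfolding has_log_deriv_def by (simp add: algebra_simps)
qed

lemma has_log_deriv_prod:
  "finite I \<Longrightarrow> (\<And>i. i \<in> I \<Longrightarrow> has_log_deriv (f i) (u i)) \<Longrightarrow>
   has_log_deriv (\<Prod>i\<in>I. f i) (\<Sum>i\<in>I. u i)"
  by (induction I rule: finite_induct) (auto simp: has_log_deriv_1 has_log_deriv_mult)

lemma has_log_deriv_power: "has_log_deriv f u \<Longrightarrow> has_log_deriv (f ^ k) (of_nat k * u)"
  by (induction k) (auto simp: has_log_deriv_1 algebra_simps dest: has_log_deriv_mult)

lemma has_log_deriv_inverse:
  assumes "f * g = 1" "has_log_deriv g u"
  shows "has_log_deriv f (- u)"
proof -
  have "fps_deriv f * g + f * fps_deriv g = 0"
    using arg_cong[OF assms(1), of fps_deriv] by (simp add: add.commute)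
  moreover have "(f * g) * (fps_X * fps_deriv f) + f * f * (fps_X * fps_deriv g) =
      fps_X * f * (fps_deriv f * g + f * fps_deriv g)"
    by (simp only: algebra_simps)
  moreover have "f * f * (fps_X * fps_deriv g) = (f * g) * (f * u)"
    using assms(2) unfolding has_log_deriv_def by (simp only: ac_simps)
  ultimately have "(f * g) * (fps_X * fps_deriv f) + (f * g) * (f * u) = 0"
    by simp
  then have "fps_X * fps_deriv f + f * u = 0"
    unfolding assms(1) by simp
  then show ?thesis
    unfolding has_log_deriv_def by (simp add: eq_neg_iff_add_eq_0)
qed

text \<open>
  The Lambert series $i\,q^i/(1-q^i)$.
\<close>

definition lambert :: "nat \<Rightarrow> int fps" where
  "lambert i = Abs_fps (\<lambda>n. if 0 < n \<and> i dvd n then int i else 0)"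

lemma has_log_deriv_one_minus_X_power:
  assumes "0 < i"
  shows "has_log_deriv (1 - fps_X ^ i) (- lambert i)"
  unfolding has_log_deriv_def
proof (rule fps_ext)
  fix n
  have "fps_nth (fps_X * fps_deriv (1 - fps_X ^ i :: int fps)) n = - (if n = i then int i else 0)"
    using assms by (cases n) (auto simp: fps_X_power_iff)
  also have "\<dots> = (if n < i then 0 else fps_nth (lambert i) (n - i)) - fps_nth (lambert i) n"
    using assms by (auto simp: lambert_def dvd_minus_self dest: dvd_imp_le)
  also have "\<dots> = fps_nth ((1 - fps_X ^ i) * (- lambert i)) n"
    by (simp add: mult.commute[of "1 - _"] fps_nth_mult_one_minus_X_power)
  finally show "fps_nth (fps_X * fps_deriv (1 - fps_X ^ i)) n = fps_nth ((1 - fps_X ^ i) * (- lambert i)) n" .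
qed

lemma has_log_deriv_coeff:
  assumes "has_log_deriv f u"
  shows "of_nat n * fps_nth f n = (\<Sum>k=0..n. fps_nth u k * fps_nth f (n - k))"
proof -
  have "of_nat n * fps_nth f n = fps_nth (fps_X * fps_deriv f) n"
    by (cases n) auto
  also have "\<dots> = fps_nth (u * f) n"
    using assms unfolding has_log_deriv_def by (simp add: mult.commute)
  finally show ?thesis by (simp add: fps_mult_nth)
qed

section \<open>Congruences of power series\<close>

text \<open>
  Congruence modulo $m$ in an arbitrary commutative ring is expressed as divisibility of the difference.
\<close>

lemma dvd_diff_trans: "(m::'a::comm_ring_1) dvd a - b \<Longrightarrow> m dvd b - c \<Longrightarrow> m dvd a - c"
  using dvd_add by fastforce

lemma dvd_diff_mult:
  "(m::'a::comm_ring_1) dvd a - b \<Longrightarrow> m dvd c - d \<Longrightarrow> m dvd a * c - b * d"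
proof -
  assume "m dvd a - b" "m dvd c - d"
  then have "m dvd (a - b) * c + b * (c - d)" by (intro dvd_add dvd_mult dvd_mult2)
  then show ?thesis by (simp add: algebra_simps)
qed

lemma dvd_diff_prod:
  "(\<And>i. i \<in> I \<Longrightarrow> (m::'a::comm_ring_1) dvd f i - g i) \<Longrightarrow> m dvd prod f I - prod g I"
  by (induction I rule: infinite_finite_induct) (auto intro: dvd_diff_mult)

lemma one_minus_power_5_cong: "5 dvd (1 - y) ^ 5 - (1 - y ^ 5 :: 'a :: comm_ring_1)"
proof
  show "(1 - y) ^ 5 - (1 - y ^ 5) = 5 * (y ^ 4 - 2 * y ^ 3 + 2 * y\<^sup>2 - y)"
    by (simp add: eval_nat_numeral algebra_simps)
qed

lemma dvd_fps_nth: "of_int m dvd (f :: int fps) \<Longrightarrow> m dvd fps_nth f n"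
  by (auto elim!: dvdE simp: fps_of_int[symmetric])

lemma fps_nth_mult_prod_high:
  assumes "finite J" "\<And>j. j \<in> J \<Longrightarrow> n < j"
  shows "fps_nth (f * (\<Prod>j\<in>J. 1 - fps_X ^ j)) n = fps_nth (f :: 'a :: comm_ring_1 fps) n"
  using assms
proof (induction J arbitrary: f rule: finite_induct)
  case (insert j J)
  have "fps_nth (f * (\<Prod>j\<in>insert j J. 1 - fps_X ^ j)) n =
    fps_nth ((f * (1 - fps_X ^ j)) * (\<Prod>j\<in>J. 1 - fps_X ^ j)) n"
    using insert by (simp add: mult.assoc)
  also have "\<dots> = fps_nth (f * (1 - fps_X ^ j)) n"
    using insert by blast
  also have "\<dots> = fps_nth f n"
    using insert by (simp add: fps_nth_mult_one_minus_X_power)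
  finally show ?case .
qed simp

text \<open>
  Parts of a partition of $n$ are at most $n$, so a finite product suffices for the $n$-th coefficient.
\<close>

lemma num_regular_partitions_gf:
  assumes "0 < l"
  shows "int (num_regular_partitions l (int n)) = fps_nth (mset_gf {i\<in>{1..n}. \<not> l dvd i}) n"
proof -
  have "regular_partitions l n = {M. set_mset M \<subseteq> {i\<in>{1..n}. \<not> l dvd i} \<and> sum_mset M = n}"
    using assms
    by (auto simp: regular_partitions_def partitions_def Suc_le_eq dest: multi_member_split intro!: gr0I)
  then show ?thesis by (simp add: num_regular_partitions_def mset_gf_def)
qed

section \<open>The eta quotient and Ramanujan's identity\<close>

text \<open>
  A truncation of $\prod_i (1-q^{5i})^5/(1-q^i)$ that is correct up to $q^N$, with the factors grouped as
  $\prod_i (1-q^i)^{-1} \prod_{5 \mid i} (1-q^i)^5$.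
\<close>

definition eta_quot :: "nat \<Rightarrow> int fps" where
  "eta_quot N = mset_gf {1..N} * (\<Prod>i\<in>{i\<in>{1..N}. 5 dvd i}. (1 - fps_X ^ i) ^ 5)"

lemma weighted_sigma_eq:
  assumes "0 < k" "k \<le> N"
  shows "weighted_sigma k = (\<Sum>i=1..N. if i dvd k then int i * weight5 i else 0)"
proof -
  have "weighted_sigma k = (\<Sum>i\<in>{i\<in>{1..N}. i dvd k}. int i * weight5 i)"
    unfolding weighted_sigma_def
  proof (rule sum.reindex_bij_witness[where i = "\<lambda>i. (i, k div i)" and j = fst])
    fix q assume "q \<in> {(b, y). b * y = k}"
    then have "fst q dvd k" by auto
    then show "fst q \<in> {i \<in> {1..N}. i dvd k}"
      using assms dvd_imp_le[of "fst q" k] by (auto simp: Suc_le_eq intro!: gr0I)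
  qed (use assms in \<open>auto intro!: gr0I\<close>)
  also have "\<dots> = (\<Sum>i=1..N. if i dvd k then int i * weight5 i else 0)"
    by (rule sum.inter_filter) simp
  finally show ?thesis .
qed

lemma eta_quot_log_deriv:
  obtains u where "has_log_deriv (eta_quot N) u" "fps_nth u 0 = 0"
    "\<And>k. 0 < k \<Longrightarrow> k \<le> N \<Longrightarrow> fps_nth u k = weighted_sigma k"
proof
  let ?I = "{i\<in>{1..N}. 5 dvd i}"
  let ?u = "- (\<Sum>i\<in>{1..N}. - lambert i) + (\<Sum>i\<in>?I. of_nat 5 * (- lambert i))"
  have "has_log_deriv (mset_gf {1..N}) (- (\<Sum>i\<in>{1..N}. - lambert i))"
    by (rule has_log_deriv_inverse[OF mset_gf_times_prod])
       (auto intro!: has_log_deriv_prod has_log_deriv_one_minus_X_power)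
  moreover have "has_log_deriv (\<Prod>i\<in>?I. (1 - fps_X ^ i) ^ 5) (\<Sum>i\<in>?I. of_nat 5 * (- lambert i))"
    by (intro has_log_deriv_prod has_log_deriv_power has_log_deriv_one_minus_X_power) auto
  ultimately show "has_log_deriv (eta_quot N) ?u"
    unfolding eta_quot_def by (rule has_log_deriv_mult)
  have five: "fps_nth (of_nat 5 * f) k = 5 * fps_nth f k" for f :: "int fps" and k
    by (simp add: fps_of_nat[symmetric] del: of_nat_numeral)
  have nth: "fps_nth ?u k = (\<Sum>i=1..N. if 0 < k \<and> i dvd k then int i * weight5 i else 0)" for k
  proof -
    have "fps_nth ?u k = (\<Sum>i=1..N. fps_nth (lambert i) k) - (\<Sum>i\<in>?I. 5 * fps_nth (lambert i) k)"
      unfolding fps_add_nth fps_sum_nth fps_neg_nth five by (simp add: sum_negf)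
    also have "(\<Sum>i\<in>?I. 5 * fps_nth (lambert i) k) =
        (\<Sum>i=1..N. if 5 dvd i then 5 * fps_nth (lambert i) k else 0)"
      by (rule sum.inter_filter) simp
    finally show ?thesis
      unfolding sum_subtractf[symmetric]
      by (auto intro!: sum.cong simp: lambert_def weight5_def)
  qed
  show "fps_nth ?u 0 = 0" unfolding nth by simp
  show "fps_nth ?u k = weighted_sigma k" if "0 < k" "k \<le> N" for k
    unfolding nth weighted_sigma_eq[OF that] using that by simp
qed

lemma twisted_sigma_1: "twisted_sigma (Suc 0) = 1"
proof -
  have "{(a, x). a * x = Suc 0} = {(1, 1)}" by auto
  then show ?thesis by (simp add: twisted_sigma_def legendre5_def)
qed

lemma eta_quot_nth_0: "fps_nth (eta_quot N) 0 = 1"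
proof -
  have "fps_nth (mset_gf {1..N} * (\<Prod>i\<in>{1..N}. 1 - fps_X ^ i)) 0 = fps_nth (mset_gf {1..N}) 0"
    by (rule fps_nth_mult_prod_high) auto
  then have "fps_nth (mset_gf {1..N}) 0 = 1"
    by (subst (asm) mset_gf_times_prod) auto
  moreover have "fps_nth (\<Prod>i\<in>I. (1 - fps_X ^ i) ^ 5 :: int fps) 0 = 1" if "0 \<notin> I" for I
    using that by (induction I rule: infinite_finite_induct) (auto simp: fps_nth_power_0 power_0_left)
  ultimately show ?thesis by (simp add: eta_quot_def)
qed

text \<open>
  Ramanujan's identity up to the truncation. Both sides satisfy the recurrence with the weights
  \<open>weighted_sigma\<close>, and a positive $k$ can be cancelled from $k\,c(k)$.
\<close>

lemma eta_quot_nth: "k \<le> N \<Longrightarrow> fps_nth (eta_quot N) k = twisted_sigma (k + 1)"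
proof (induction k rule: less_induct)
  case (less k)
  show ?case
  proof (cases "k = 0")
    case True
    then show ?thesis by (simp add: eta_quot_nth_0 twisted_sigma_1)
  next
    case False
    obtain u where u: "has_log_deriv (eta_quot N) u" "fps_nth u 0 = 0"
      "\<And>k. 0 < k \<Longrightarrow> k \<le> N \<Longrightarrow> fps_nth u k = weighted_sigma k"
      using eta_quot_log_deriv[of N] by blast
    have "int k * fps_nth (eta_quot N) k = (\<Sum>j=1..k. fps_nth u j * fps_nth (eta_quot N) (k - j))"
      using has_log_deriv_coeff[OF u(1), of k] by (simp add: sum.atLeast_Suc_atMost u(2))
    also have "\<dots> = (\<Sum>j=1..k. weighted_sigma j * twisted_sigma (k + 1 - j))"
    proof (intro sum.cong refl arg_cong2[where f = "(*)"])
      fix j assume j: "j \<in> {1..k}"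
      then show "fps_nth u j = weighted_sigma j" using u(3) less.prems by auto
      have "fps_nth (eta_quot N) (k - j) = twisted_sigma (k - j + 1)"
        using j less.prems by (intro less.IH) auto
      also have "k - j + 1 = k + 1 - j" using j by auto
      finally show "fps_nth (eta_quot N) (k - j) = twisted_sigma (k + 1 - j)" .
    qed
    also have "\<dots> = int k * twisted_sigma (k + 1)"
      by (rule twisted_sigma_recurrence[symmetric])
    finally show ?thesis using False by simp
  qed
qed

text \<open>
  Replacing each $(1-q^i)^5$ with $5 \mid i$ by $1-q^{5i}$ introduces exactly the factors
  $1-q^j$ with $25 \mid j$. Those with $j \le n$ cancel the parts divisible by 25, and those with
  $j > n$ do not affect the $n$-th coefficient.
\<close>

lemma num_regular_partitions_25_cong_twisted_sigma:
  "5 dvd int (num_regular_partitions 25 (int n)) - twisted_sigma (n + 1)"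
proof -
  let ?E = "\<lambda>I. \<Prod>i\<in>I. 1 - fps_X ^ i :: int fps"
  let ?I = "{1..n}"
  let ?R = "{i\<in>?I. \<not> 25 dvd i}" and ?S = "{i\<in>?I. 25 dvd i}" and ?F = "{i\<in>?I. 5 dvd i}"
  let ?J = "{j\<in>(*) 5 ` ?F. n < j}"
  have "5 dvd (\<Prod>i\<in>?F. (1 - fps_X ^ i) ^ 5) - (\<Prod>i\<in>?F. 1 - (fps_X ^ i) ^ 5 :: int fps)"
    by (intro dvd_diff_prod one_minus_power_5_cong)
  also have "(\<Prod>i\<in>?F. 1 - (fps_X ^ i) ^ 5 :: int fps) = ?E ((*) 5 ` ?F)"
    by (subst prod.reindex) (auto simp: inj_on_def mult.commute[of 5] power_mult)
  also have "(*) 5 ` ?F = ?S \<union> ?J"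
    by (auto elim!: dvdE)
  also have "?E (?S \<union> ?J) = ?E ?S * ?E ?J"
    by (rule prod.union_disjoint) auto
  finally have "5 dvd mset_gf ?I * (\<Prod>i\<in>?F. (1 - fps_X ^ i) ^ 5) - mset_gf ?I * (?E ?S * ?E ?J)"
    by (intro dvd_diff_mult) simp_all
  moreover have "mset_gf ?I * ?E ?S = mset_gf ?R"
  proof -
    have RS: "?I = ?R \<union> ?S" by auto
    have "?E ?I = ?E ?R * ?E ?S"
      by (subst RS, rule prod.union_disjoint) auto
    then have "mset_gf ?I * ?E ?S = (mset_gf ?R * ?E ?R) * (mset_gf ?I * ?E ?S)"
      by (subst mset_gf_times_prod) auto
    also have "\<dots> = mset_gf ?R * (mset_gf ?I * ?E ?I)"
      unfolding \<open>?E ?I = _\<close> by (simp only: ac_simps)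
    also have "\<dots> = mset_gf ?R" by (subst mset_gf_times_prod) auto
    finally show ?thesis .
  qed
  ultimately have "of_int 5 dvd eta_quot n - mset_gf ?R * ?E ?J"
    unfolding eta_quot_def by (simp flip: mult.assoc)
  then have "5 dvd fps_nth (eta_quot n - mset_gf ?R * ?E ?J) n"
    by (rule dvd_fps_nth)
  moreover have "fps_nth (mset_gf ?R * ?E ?J) n = fps_nth (mset_gf ?R) n"
    by (rule fps_nth_mult_prod_high) auto
  ultimately have "5 dvd twisted_sigma (n + 1) - int (num_regular_partitions 25 (int n))"
    by (simp add: eta_quot_nth num_regular_partitions_gf)
  then show ?thesis by (subst dvd_diff_commute)
qed

section \<open>Divisor sums modulo 5\<close>

definition divisor_sum :: "nat \<Rightarrow> nat" where
  "divisor_sum m = (\<Sum>d | d dvd m. d)"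

text \<open>
  Multiplication by $p$ pairs the divisors with even $p$-adic valuation with those with odd valuation,
  because the valuation of $m$ itself is odd; each pair contributes a multiple of $1+p$.
\<close>

lemma Suc_prime_dvd_divisor_sum:
  assumes "prime p" "0 < m" "odd (multiplicity p m)"
  shows "Suc p dvd divisor_sum m"
proof -
  let ?v = "multiplicity p"
  have D: "{d. d dvd m} = {d. d dvd m \<and> even (?v d)} \<union> {d. d dvd m \<and> odd (?v d)}" by auto
  have fin: "finite {d. d dvd m \<and> P d}" for P
    using finite_divisors_nat[OF assms(2)] by (rule finite_subset[rotated]) auto
  have "bij_betw (\<lambda>d. p * d) {d. d dvd m \<and> even (?v d)} {d. d dvd m \<and> odd (?v d)}"
  proof (rule bij_betw_byWitness[where f' = "\<lambda>d. d div p"])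
    show "(\<lambda>d. p * d) ` {d. d dvd m \<and> even (?v d)} \<subseteq> {d. d dvd m \<and> odd (?v d)}"
    proof clarify
      fix d assume d: "d dvd m" "even (?v d)"
      have d0: "d \<noteq> 0" using d assms by auto
      have "?v (p * d) = Suc (?v d)"
        using assms d0 by (subst prime_elem_multiplicity_mult_distrib) auto
      moreover obtain k where k: "m = d * k" using d by blast
      have "?v m = ?v d + ?v k"
        unfolding k using assms k by (subst prime_elem_multiplicity_mult_distrib) auto
      then have "?v k \<noteq> 0" using assms(3) d(2) by (metis add.right_neutral)
      then have "p dvd k" by (metis not_dvd_imp_multiplicity_0)
      ultimately show "p * d dvd m \<and> odd (?v (p * d))" using d(2) k by (auto simp: mult.commute)
    qed
    show "(\<lambda>d. d div p) ` {d. d dvd m \<and> odd (?v d)} \<subseteq> {d. d dvd m \<and> even (?v d)}"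
    proof clarify
      fix d assume d: "d dvd m" "odd (?v d)"
      then have "p dvd d" by (metis even_zero not_dvd_imp_multiplicity_0)
      then obtain k where k: "d = p * k" by blast
      have "k \<noteq> 0" using k d assms by auto
      then have "?v d = Suc (?v k)"
        unfolding k using assms by (subst prime_elem_multiplicity_mult_distrib) auto
      then show "d div p dvd m \<and> even (?v (d div p))"
        using d k assms(1) by (auto simp: prime_gt_0_nat dest: dvd_mult_right)
    qed
    show "\<forall>d\<in>{d. d dvd m \<and> odd (?v d)}. p * (d div p) = d"
      by (auto, metis even_zero not_dvd_imp_multiplicity_0 dvd_mult_div_cancel)
  qed (use assms(1) in \<open>auto simp: prime_gt_0_nat\<close>)
  then have "(\<Sum>d | d dvd m \<and> odd (?v d). d) = (\<Sum>d | d dvd m \<and> even (?v d). p * d)"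
    by (rule sum.reindex_bij_betw[symmetric])
  then have "divisor_sum m = Suc p * (\<Sum>d | d dvd m \<and> even (?v d). d)"
    unfolding divisor_sum_def by (subst D, subst sum.union_disjoint[OF fin fin]) (auto simp: sum_distrib_left sum.distrib)
  then show ?thesis by (simp only: dvd_triv_left)
qed

lemma legendre5_cong_square: "5 dvd legendre5 a - (int a)\<^sup>2"
proof -
  have "int a mod 5 = int (a mod 5)" by (simp add: zmod_int)
  moreover have "a mod 5 < 5" by simp
  ultimately have "(legendre5 a) mod 5 = (int a)\<^sup>2 mod 5"
    unfolding legendre5_def power_mod[of "int a", symmetric]
    by (elim less_5_cases[THEN disjE] disjE) simp_all
  then show ?thesis by (simp add: mod_eq_dvd_iff)
qed

lemma twisted_sigma_cong_divisor_sum: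
  assumes "0 < m"
  shows "5 dvd twisted_sigma m - int (m * divisor_sum m)"
proof -
  have "divisor_sum m = (\<Sum>(a, x)\<in>{(a, x). a * x = m}. a)"
    unfolding divisor_sum_def
    by (rule sum.reindex_bij_witness[where j = "\<lambda>i. (i, m div i)" and i = fst])
       (use assms in \<open>auto intro!: gr0I\<close>)
  then have "int (m * divisor_sum m) = (\<Sum>(a, x)\<in>{(a, x). a * x = m}. (int a)\<^sup>2 * int x)"
    by (auto simp: sum_distrib_left power2_eq_square intro!: sum.cong)
  then have "twisted_sigma m - int (m * divisor_sum m) =
      (\<Sum>(a, x)\<in>{(a, x). a * x = m}. (legendre5 a - (int a)\<^sup>2) * int x)"
    by (simp add: twisted_sigma_def sum_subtractf[symmetric] case_prod_unfold left_diff_distrib)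
  then show ?thesis
    by (auto intro!: dvd_sum dvd_mult2 legendre5_cong_square)
qed

section \<open>Divisibility of the number of 25-regular partitions\<close>

theorem five_dvd_num_regular_partitions_25_iff:
  assumes "0 < m"
  shows "5 dvd num_regular_partitions 25 (int m - 1) \<longleftrightarrow> 5 dvd m * divisor_sum m"
proof -
  have "5 dvd int (num_regular_partitions 25 (int (m - 1))) - int (m * divisor_sum m)"
    using dvd_diff_trans[OF num_regular_partitions_25_cong_twisted_sigma[of "m - 1"]] twisted_sigma_cong_divisor_sum[OF assms] assms
    by simp
  moreover have "int (m - 1) = int m - 1" using assms by simp
  ultimately have "(5::int) dvd int (num_regular_partitions 25 (int m - 1)) \<longleftrightarrow> 5 dvd int (m * divisor_sum m)"
    by (metis dvd_add_right_iff diff_add_cancel add.commute dvd_add_left_iff)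
  then show ?thesis by presburger
qed

lemma divisor_sum_prime: "prime p \<Longrightarrow> divisor_sum p = p + 1"
proof -
  assume p: "prime p"
  then have "{d. d dvd p} = {1, p}" by (auto simp: prime_nat_iff)
  then show ?thesis using prime_gt_1_nat[OF p] by (simp add: divisor_sum_def)
qed

lemma five_dvd_num_regular_partitions_25:
  assumes "prime p" "5 dvd num_regular_partitions 25 (int p - 1)"
    and "0 < m" "odd (multiplicity p m)"
  shows "5 dvd num_regular_partitions 25 (int m - 1)"
proof -
  have "5 dvd p * (p + 1)"
    using assms(1,2) five_dvd_num_regular_partitions_25_iff[of p] divisor_sum_prime[of p]
    by (simp add: prime_gt_0_nat)
  moreover have "prime (5::nat)" by simp
  ultimately have "5 dvd p \<or> 5 dvd p + 1" using prime_dvd_mult_iff by blast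
  then have "5 dvd m * divisor_sum m"
  proof
    assume "5 dvd p"
    moreover have "p dvd m" using assms(4) by (metis even_zero not_dvd_imp_multiplicity_0)
    ultimately show ?thesis using dvd_trans dvd_mult2 by blast
  next
    assume "5 dvd p + 1"
    then show ?thesis using Suc_prime_dvd_divisor_sum[OF assms(1,3,4)] by (metis Suc_eq_plus1 dvd_trans dvd_mult)
  qed
  then show ?thesis using five_dvd_num_regular_partitions_25_iff[OF assms(3)] by simp
qed

theorem theorem1p4:
  fixes \<alpha> n :: nat and p :: "nat \<Rightarrow> nat" and j :: int
  assumes "\<And>i. i \<in> {1..\<alpha>+1} \<Longrightarrow> prime (p i)"
    and "\<And>i. i \<in> {1..\<alpha>+1} \<Longrightarrow> [num_regular_partitions 25 (int (p i) - 1) = 0] (mod 5)"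
    and "\<not> [j = 0] (mod int (p (\<alpha>+1)))"
  shows "[num_regular_partitions 25
            ((\<Prod>i=1..\<alpha>+1. (int (p i))\<^sup>2) * int n
             + (\<Prod>i=1..\<alpha>. (int (p i))\<^sup>2) * int (p (\<alpha>+1)) * (j + int (p (\<alpha>+1))) - 1) = 0] (mod 5)"
proof -
  define q where "q = p (\<alpha> + 1)"
  define P where "P = (\<Prod>i=1..\<alpha>. p i)"
  define v where "v = int q * int n + j + int q"
  have q: "prime q" unfolding q_def using assms(1) by simp
  have P0: "P \<noteq> 0"
    unfolding P_def using assms(1) by (auto simp: prime_gt_0_nat intro!: Nat.gr0I)
  have "\<not> int q dvd j" using assms(3) unfolding q_def by (simp add: cong_0_iff)
  then have v: "\<not> int q dvd v"
    unfolding v_def by (simp add: dvd_add_right_iff dvd_add_left_iff)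
  have sq: "(\<Prod>i=1..\<alpha>. (int (p i))\<^sup>2) = int (P\<^sup>2)"
    by (simp add: P_def prod_power_distrib)
  have arg: "(\<Prod>i=1..\<alpha>+1. (int (p i))\<^sup>2) * int n
      + (\<Prod>i=1..\<alpha>. (int (p i))\<^sup>2) * int (p (\<alpha>+1)) * (j + int (p (\<alpha>+1)))
    = int (P\<^sup>2 * q) * v"
    using sq by (simp add: q_def v_def algebra_simps power2_eq_square)
  have "5 dvd num_regular_partitions 25 (int (P\<^sup>2 * q) * v - 1)"
  proof (cases "v \<le> 0")
    case True
    \<comment> \<open>The argument of the count is negative, where the count is zero by convention.\<close>
    then have "int (P\<^sup>2 * q) * v \<le> 0" by (intro mult_nonneg_nonpos) auto
    then show ?thesis by (simp add: num_regular_partitions_neg)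
  next
    case False
    define w where "w = nat v"
    have w: "v = int w" using False by (simp add: w_def)
    have "\<not> q dvd w" using v unfolding w by simp
    then have "multiplicity q w = 0" "w \<noteq> 0" by (auto simp: not_dvd_imp_multiplicity_0 intro!: gr0I)
    then have "multiplicity q (P\<^sup>2 * q * w) = Suc (2 * multiplicity q P)"
      using q P0 prime_gt_0_nat[OF q]
      by (simp add: prime_elem_multiplicity_mult_distrib prime_elem_multiplicity_power_distrib)
    then have "odd (multiplicity q (P\<^sup>2 * q * w))" by simp
    moreover have "0 < P\<^sup>2 * q * w" using P0 q \<open>w \<noteq> 0\<close> by (simp add: prime_gt_0_nat)
    moreover have "5 dvd num_regular_partitions 25 (int q - 1)"
      using assms(2)[of "\<alpha> + 1"] unfolding q_def by (simp add: cong_0_iff)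
    ultimately have "5 dvd num_regular_partitions 25 (int (P\<^sup>2 * q * w) - 1)"
      using five_dvd_num_regular_partitions_25 q by blast
    then show ?thesis by (simp add: w)
  qed
  then show ?thesis unfolding arg by (simp add: cong_0_iff)
qed

end
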